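(* Let $\mathbf{X}=(\mathbf{x}_1,\dots,\mathbf{x}_n)\in\mathbb{R}^{p\times n}$ and $\mathbf{F}=(\mathbf{f}_1,\dots,\mathbf{f}_n)\in\mathbb{R}^{p\times n}$ be matrices with columns $\mathbf{x}_i,\mathbf{f}_i\in\mathbb{R}^p$, and let $\delta>0$. Define $\widetilde{\mathbf{X}}=(\tilde{\mathbf{x}}_1,\dots,\tilde{\mathbf{x}}_n)\in\mathbb{R}^{p\times n}$ columnwise by $$\tilde{\mathbf{x}}_i=\begin{cases}\mathbf{x}_i & \text{if } \|\mathbf{x}_i-\mathbf{f}_i\|\le\delta,\\[4pt] \mathbf{f}_i+\delta\,\dfrac{\mathbf{x}_i-\mathbf{f}_i}{\|\mathbf{x}_i-\mathbf{f}_i\|} & \text{if } \|\mathbf{x}_i-\mathbf{f}_i\|>\delta,\end{cases}\qquad i=1,\dots,n.$$ Then $\widetilde{\mathbf{X}}$ is the optimal solution of the following minimization problem over $\mathbf{Z}\in\mathbb{R}^{p\times n}$: $$\widetilde{\mathbf{X}}=\arg\min_{\mathbf{Z}\in\mathbb{R}^{p\times n}}\ \|\mathbf{X}-\mathbf{Z}\|_{2,1}+\frac{1}{2\delta}\|\mathbf{Z}-\mathbf{F}\|_F^2 .$$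
   Context: $\|\mathbf{v}\|$ denotes the Euclidean norm of a vector $\mathbf{v}$. For a matrix $\mathbf{A}=(\mathbf{a}_1,\dots,\mathbf{a}_n)\in\mathbb{R}^{p\times n}$ with columns $\mathbf{a}_i$, $\|\mathbf{A}\|_{2,1}=\sum_{i=1}^n\|\mathbf{a}_i\|$ (sum of the Euclidean norms of the columns), and $\|\mathbf{A}\|_F$ is the Frobenius norm, so $\|\mathbf{A}\|_F^2=\sum_{i=1}^n\|\mathbf{a}_i\|^2$. *)

theory Defs
  imports "HOL-Analysis.Analysis"
begin

text \<open>A matrix with \<open>p\<close> rows and \<open>n\<close> columns has type \<open>real ^ 'n ^ 'p\<close>, so \<open>A $ i $ j\<close> is the
  entry in row \<open>i\<close> and column \<open>j\<close>, and \<open>column j A\<close> is a vector of type \<open>real ^ 'p\<close> whose \<open>norm\<close> is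
  the Euclidean norm.\<close>

definition norm_2_1 :: "real ^ 'n ^ 'p \<Rightarrow> real" where
  "norm_2_1 A = (\<Sum>j\<in>UNIV. norm (column j A))"

definition frobenius_norm :: "real ^ 'n ^ 'p \<Rightarrow> real" where
  "frobenius_norm A = sqrt (\<Sum>i\<in>UNIV. \<Sum>j\<in>UNIV. (A $ i $ j)\<^sup>2)"

lemma frobenius_norm_eq_norm: "frobenius_norm A = norm A"
  by (simp add: frobenius_norm_def norm_vec_def L2_set_def sum_nonneg)

lemma frobenius_norm_power2: "(frobenius_norm A)\<^sup>2 = (\<Sum>j\<in>UNIV. (norm (column j A))\<^sup>2)"
proof -
  have "(frobenius_norm A)\<^sup>2 = (\<Sum>i\<in>UNIV. \<Sum>j\<in>UNIV. (A $ i $ j)\<^sup>2)"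
    by (simp add: frobenius_norm_def sum_nonneg)
  also have "\<dots> = (\<Sum>j\<in>UNIV. \<Sum>i\<in>UNIV. (A $ i $ j)\<^sup>2)"
    by (rule sum.swap)
  also have "\<dots> = (\<Sum>j\<in>UNIV. (norm (column j A))\<^sup>2)"
    by (simp add: norm_vec_def L2_set_def sum_nonneg column_def)
  finally show ?thesis .
qed

definition clip_vec :: "real \<Rightarrow> real ^ 'p \<Rightarrow> real ^ 'p \<Rightarrow> real ^ 'p" where
  "clip_vec \<delta> x f =
     (if norm (x - f) \<le> \<delta> then x else f + \<delta> *\<^sub>R ((1 / norm (x - f)) *\<^sub>R (x - f)))"

definition clip_columns :: "real \<Rightarrow> real ^ 'n ^ 'p \<Rightarrow> real ^ 'n ^ 'p \<Rightarrow> real ^ 'n ^ 'p" where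
  "clip_columns \<delta> X F = (\<chi> i j. clip_vec \<delta> (column j X) (column j F) $ i)"

lemma column_clip_columns: "column j (clip_columns \<delta> X F) = clip_vec \<delta> (column j X) (column j F)"
  by (simp add: clip_columns_def column_def vec_eq_iff)

end

theory Submission imports Defs begin

text \<open>The objective splits over the columns into functions
  \<open>h(z) = \<parallel>x - z\<parallel> + \<parallel>z - f\<parallel>\<^sup>2 / (2\<delta>)\<close>. With \<open>c\<close> the clipped column, the vector
  \<open>g = (c - f) / \<delta>\<close> lies in the unit ball and satisfies \<open>g \<bullet> (x - c) = \<parallel>x - c\<parallel>\<close>, so \<open>-g\<close> is a
  subgradient of \<open>\<parallel>x - \<cdot>\<parallel>\<close> at \<open>c\<close>. It cancels the linear term of the quadratic part, which leaves
  \<open>h(z) \<ge> h(c) + \<parallel>z - c\<parallel>\<^sup>2 / (2\<delta>)\<close>; summing over the columns gives minimality and uniqueness.\<close>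

lemma clip_vec_subgradient:
  fixes x f :: "real ^ 'p"
  assumes "\<delta> > 0"
  obtains g where "norm g \<le> 1" "clip_vec \<delta> x f - f = \<delta> *\<^sub>R g"
    "g \<bullet> (x - clip_vec \<delta> x f) = norm (x - clip_vec \<delta> x f)"
proof (cases "norm (x - f) \<le> \<delta>")
  \<comment> \<open>Here the clipped vector is \<open>x\<close> itself, so both sides of the inner
    product condition are 0.\<close>
  case True
  then have "norm ((1 / \<delta>) *\<^sub>R (x - f)) \<le> 1"
    using assms by (simp del: scaleR_right_diff_distrib)
  with True assms show ?thesis
    by (intro that[of "(1 / \<delta>) *\<^sub>R (x - f)"]) (simp_all add: clip_vec_def)
next
  case False
  define r where "r = norm (x - f)"
  define g where "g = (1 / r) *\<^sub>R (x - f)"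
  have r: "r > \<delta>" "r > 0"
    using False assms unfolding r_def by linarith+
  have ng: "norm g = 1" and xf: "x - f = r *\<^sub>R g"
    using r by (simp_all add: g_def del: scaleR_right_diff_distrib flip: r_def)
  have c: "clip_vec \<delta> x f = f + \<delta> *\<^sub>R g"
    using False by (simp add: clip_vec_def g_def r_def)
  \<comment> \<open>A nonnegative multiple of the unit vector \<open>g\<close>: the equality case of
    Cauchy-Schwarz.\<close>
  have xc: "x - clip_vec \<delta> x f = (r - \<delta>) *\<^sub>R g"
    unfolding c scaleR_left_diff_distrib xf[symmetric] by simp
  show ?thesis
  proof (rule that[of g])
    show "g \<bullet> (x - clip_vec \<delta> x f) = norm (x - clip_vec \<delta> x f)"
      using r ng by (simp add: xc dot_square_norm)
  qed (simp_all add: ng c)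
qed

lemma clip_vec_quadratic_growth:
  fixes x f z :: "real ^ 'p"
  assumes "\<delta> > 0"
  defines "c \<equiv> clip_vec \<delta> x f"
  shows "norm (x - c) + 1 / (2 * \<delta>) * (norm (c - f))\<^sup>2 + 1 / (2 * \<delta>) * (norm (z - c))\<^sup>2
         \<le> norm (x - z) + 1 / (2 * \<delta>) * (norm (z - f))\<^sup>2"
proof -
  obtain g where g: "norm g \<le> 1" "c - f = \<delta> *\<^sub>R g" "g \<bullet> (x - c) = norm (x - c)"
    unfolding c_def by (rule clip_vec_subgradient[OF assms(1)])
  have "g \<bullet> (x - z) \<le> norm g * norm (x - z)"
    by (rule norm_cauchy_schwarz)
  also have "\<dots> \<le> norm (x - z)"
    using g(1) by (simp add: mult_left_le_one_le)
  finally have "norm (x - c) - g \<bullet> (z - c) \<le> norm (x - z)"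
    using g(3) by (simp add: inner_diff_right)
  moreover have "(norm (z - f))\<^sup>2 = (norm ((z - c) + (c - f)))\<^sup>2"
    by simp
  then have "(norm (z - f))\<^sup>2 = (norm (z - c))\<^sup>2 + 2 * \<delta> * (g \<bullet> (z - c)) + (norm (c - f))\<^sup>2"
    by (simp only: g(2) power2_norm_eq_inner)
      (simp add: inner_add_left inner_add_right inner_commute)
  \<comment> \<open>The weight reduces the cross term to \<open>g \<bullet> (z - c)\<close>, exactly
    what the subgradient inequality subtracts.\<close>
  then have "1 / (2 * \<delta>) * (norm (z - f))\<^sup>2
      = 1 / (2 * \<delta>) * (norm (z - c))\<^sup>2 + g \<bullet> (z - c) + 1 / (2 * \<delta>) * (norm (c - f))\<^sup>2"
    using assms(1) by (simp add: field_simps)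
  ultimately show ?thesis
    by linarith
qed

lemma column_diff: "column j (A - B) = column j A - column j (B :: real ^ 'n ^ 'p)"
  by (simp add: column_def vec_eq_iff)

lemma clip_columns_quadratic_growth:
  fixes X F Z :: "real ^ 'n ^ 'p"
  assumes "\<delta> > 0"
  defines "C \<equiv> clip_columns \<delta> X F"
  shows "norm_2_1 (X - C) + 1 / (2 * \<delta>) * (frobenius_norm (C - F))\<^sup>2
           + 1 / (2 * \<delta>) * (frobenius_norm (Z - C))\<^sup>2
         \<le> norm_2_1 (X - Z) + 1 / (2 * \<delta>) * (frobenius_norm (Z - F))\<^sup>2"
  unfolding norm_2_1_def frobenius_norm_power2 sum_distrib_left sum.distrib[symmetric]
    column_diff C_def column_clip_columns
  by (intro sum_mono clip_vec_quadratic_growth assms)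

theorem proposition3p1:
  fixes X F :: "real ^ 'n ^ 'p" and \<delta> :: real
  assumes "\<delta> > 0"
  shows "{Z :: real ^ 'n ^ 'p.
            is_arg_min (\<lambda>Z. norm_2_1 (X - Z) + 1 / (2 * \<delta>) * (frobenius_norm (Z - F))\<^sup>2)
              (\<lambda>_. True) Z}
         = {clip_columns \<delta> X F}"
proof -
  define h where
    "h = (\<lambda>Z. norm_2_1 (X - Z) + 1 / (2 * \<delta>) * (frobenius_norm (Z - F))\<^sup>2)"
  define C where "C = clip_columns \<delta> X F"
  have growth: "h C + 1 / (2 * \<delta>) * (norm (Z - C))\<^sup>2 \<le> h Z" for Z
    using clip_columns_quadratic_growth[OF assms, of X F Z]
    by (simp add: h_def C_def frobenius_norm_eq_norm)
  have less: "h C < h Z" if "Z \<noteq> C" for Z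
  proof -
    have "1 / (2 * \<delta>) * (norm (Z - C))\<^sup>2 > 0"
      using assms that by simp
    with growth[of Z] show ?thesis
      by linarith
  qed
  \<comment> \<open>Strictness does both jobs: no \<open>Z\<close> lies below \<open>h C\<close>,
    and every other \<open>Z\<close> is beaten by \<open>C\<close>.\<close>
  then have "is_arg_min h (\<lambda>_. True) Z \<longleftrightarrow> Z = C" for Z
    unfolding is_arg_min_def by (metis less_asym)
  then show ?thesis
    by (simp add: h_def C_def)
qed

end
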